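(* Let $L$ be a bounded distributive lattice with Priestley space $X$, let $\mathcal{W}$ be its ordered space of weakly prime pairs, and let $\mathcal{C}$ be the set of convex closed subsets of $X$ with the Egli-Milner order and weak hit-or-miss topology. The maps $\Phi:\mathcal{W}\to\mathcal{C}$ and $\Upsilon:\mathcal{C}\to\mathcal{W}$ given by $\Phi(F,I)=C_F\cap C_I$ and $\Upsilon(C)=(F_C,I_C)$ are mutually inverse order-homeomorphisms. Further, for each $a\in L$ we have $\Phi(\Box_a^\uparrow)=\Box_{a^-}$, $\Phi(\Box_a^\downarrow)=\Diamond_{a^-}$, $\Phi(\Diamond_a^\uparrow)=\Diamond_{a^+}$ and $\Phi(\Diamond_a^\downarrow)=\Box_{a^+}$.
   Context: The Priestley space $X$ of $L$ is the set of (proper) prime filters of $L$ ordered by inclusion, with the topology generated by the sets $a^+=\{x\in X\mid a\in x\}$ and $a^-=\{x\in X\mid a\notin x\}$, $a\in L$. A weakly prime pair $(F,I)$ of $L$ consists of a filter $F$ and an ideal $I$ of $L$ (both nonempty, possibly improper) such that for all $a,b\in L$: $a\vee b\in F$ implies $a\in F$ or $b\notin I$; and $a\wedge b\in I$ implies $a\notin F$ or $b\in I$. $\mathcal{W}$ is the set of weakly prime pairs of $L$, partially ordered by $(F,I)\leq(F',I')$ iff $F\subseteq F'$ and $I'\subseteq I$, with the topology having as a subbasis, for all $a\in L$, the sets $\Box_a^\uparrow=\{(F,I)\mid a\in F\}$, $\Box_a^\downarrow=\{(F,I)\mid a\notin F\}$, $\Diamond_a^\uparrow=\{(F,I)\mid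 a\notin I\}$, $\Diamond_a^\downarrow=\{(F,I)\mid a\in I\}$. $\mathcal{C}$ is the set of closed subsets $C$ of $X$ (including $\varnothing$) that are convex ($x,y\in C$ and $x\le z\le y$ imply $z\in C$), partially ordered by the Egli-Milner order: $A\sqsubseteq B$ iff $A\subseteq{\downarrow}B$ and $B\subseteq{\uparrow}A$. For $S\in\{a^+,a^-\}$, as subsets of $\mathcal{C}$, $\Diamond_S=\{C\in\mathcal{C}\mid C\cap S\neq\varnothing\}$ and $\Box_S=\{C\in\mathcal{C}\mid C\cap S=\varnothing\}$. The weak hit-or-miss topology on $\mathcal{C}$ is generated by the sets $\Box_{a^+},\Box_{a^-},\Diamond_{a^+},\Diamond_{a^-}$ for $a\in L$. For a filter $F$ and ideal $I$ of $L$, $C_F=\bigcap\{a^+\mid a\in F\}$ and $C_I=\bigcap\{a^-\mid a\in I\}$. For $C\in\mathcal{C}$, $F_C=\{a\in L\mid C\subseteq a^+\}$ and $I_C=\{a\in L\mid C\subseteq a^-\}$. An order-homeomorphism is a homeomorphism that is an order-isomorphism. *)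

theory Defs
  imports "HOL-Analysis.Analysis"
begin

text \<open>
  The bounded distributive lattice \<open>L\<close> is the type \<open>'a\<close>. The one-element lattice is included.
\<close>

definition lattice_filter :: "'a::{distrib_lattice,bounded_lattice} set \<Rightarrow> bool" where
  "lattice_filter F \<longleftrightarrow>
     F \<noteq> {} \<and> (\<forall>a b. a \<in> F \<longrightarrow> a \<le> b \<longrightarrow> b \<in> F) \<and> (\<forall>a\<in>F. \<forall>b\<in>F. inf a b \<in> F)"

definition lattice_ideal :: "'a::{distrib_lattice,bounded_lattice} set \<Rightarrow> bool" where
  "lattice_ideal I \<longleftrightarrow>
     I \<noteq> {} \<and> (\<forall>a b. b \<in> I \<longrightarrow> a \<le> b \<longrightarrow> a \<in> I) \<and> (\<forall>a\<in>I. \<forall>b\<in>I. sup a b \<in> I)"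

definition prime_filter :: "'a::{distrib_lattice,bounded_lattice} set \<Rightarrow> bool" where
  "prime_filter x \<longleftrightarrow>
     lattice_filter x \<and> x \<noteq> UNIV \<and> (\<forall>a b. sup a b \<in> x \<longrightarrow> a \<in> x \<or> b \<in> x)"

text \<open>The points of the Priestley space, ordered by \<open>\<subseteq>\<close>.\<close>

definition priestley_points :: "'a::{distrib_lattice,bounded_lattice} set set" where
  "priestley_points = {x. prime_filter x}"

definition pos :: "'a::{distrib_lattice,bounded_lattice} \<Rightarrow> 'a set set" where
  "pos a = {x \<in> priestley_points. a \<in> x}"

definition neg :: "'a::{distrib_lattice,bounded_lattice} \<Rightarrow> 'a set set" where
  "neg a = {x \<in> priestley_points. a \<notin> x}"

definition priestley_topology :: "'a::{distrib_lattice,bounded_lattice} set topology" where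
  "priestley_topology = topology_generated_by (range pos \<union> range neg)"

lemma topspace_priestley_topology [simp]: "topspace priestley_topology = priestley_points"
  by (auto simp: priestley_topology_def topology_generated_by_topspace pos_def neg_def)

definition up_closure :: "'a::{distrib_lattice,bounded_lattice} set set \<Rightarrow> 'a set set" where
  "up_closure A = {x \<in> priestley_points. \<exists>y\<in>A. y \<subseteq> x}"

definition down_closure :: "'a::{distrib_lattice,bounded_lattice} set set \<Rightarrow> 'a set set" where
  "down_closure A = {x \<in> priestley_points. \<exists>y\<in>A. x \<subseteq> y}"

definition weakly_prime_pair :: "'a::{distrib_lattice,bounded_lattice} set \<times> 'a set \<Rightarrow> bool" where
  "weakly_prime_pair = (\<lambda>(F, I). lattice_filter F \<and> lattice_ideal I \<and>
     (\<forall>a b. (sup a b \<in> F \<longrightarrow> a \<in> F \<or> b \<notin> I) \<and> (inf a b \<in> I \<longrightarrow> a \<notin> F \<or> b \<in> I)))"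

definition WP :: "('a::{distrib_lattice,bounded_lattice} set \<times> 'a set) set" where
  "WP = {p. weakly_prime_pair p}"

definition wp_le ::
  "'a::{distrib_lattice,bounded_lattice} set \<times> 'a set \<Rightarrow> 'a set \<times> 'a set \<Rightarrow> bool" where
  "wp_le = (\<lambda>(F, I) (F', I'). F \<subseteq> F' \<and> I' \<subseteq> I)"

definition wp_box_up ::
  "'a::{distrib_lattice,bounded_lattice} \<Rightarrow> ('a set \<times> 'a set) set" where
  "wp_box_up a = {(F, I). (F, I) \<in> WP \<and> a \<in> F}"

definition wp_box_down ::
  "'a::{distrib_lattice,bounded_lattice} \<Rightarrow> ('a set \<times> 'a set) set" where
  "wp_box_down a = {(F, I). (F, I) \<in> WP \<and> a \<notin> F}"

definition wp_dia_up ::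
  "'a::{distrib_lattice,bounded_lattice} \<Rightarrow> ('a set \<times> 'a set) set" where
  "wp_dia_up a = {(F, I). (F, I) \<in> WP \<and> a \<notin> I}"

definition wp_dia_down ::
  "'a::{distrib_lattice,bounded_lattice} \<Rightarrow> ('a set \<times> 'a set) set" where
  "wp_dia_down a = {(F, I). (F, I) \<in> WP \<and> a \<in> I}"

definition wp_topology ::
  "('a::{distrib_lattice,bounded_lattice} set \<times> 'a set) topology" where
  "wp_topology = topology_generated_by
     (range wp_box_up \<union> range wp_box_down \<union> range wp_dia_up \<union> range wp_dia_down)"

lemma topspace_wp_topology [simp]: "topspace wp_topology = WP"
  by (auto simp: wp_topology_def topology_generated_by_topspace
        wp_box_up_def wp_box_down_def wp_dia_up_def wp_dia_down_def)

definition order_convex :: "'a::{distrib_lattice,bounded_lattice} set set \<Rightarrow> bool" where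
  "order_convex C \<longleftrightarrow>
     (\<forall>x\<in>C. \<forall>y\<in>C. \<forall>z\<in>priestley_points. x \<subseteq> z \<and> z \<subseteq> y \<longrightarrow> z \<in> C)"

definition CC :: "'a::{distrib_lattice,bounded_lattice} set set set" where
  "CC = {C. closedin priestley_topology C \<and> order_convex C}"

definition egli_milner ::
  "'a::{distrib_lattice,bounded_lattice} set set \<Rightarrow> 'a set set \<Rightarrow> bool" where
  "egli_milner A B \<longleftrightarrow> A \<subseteq> down_closure B \<and> B \<subseteq> up_closure A"

text \<open>Here \<open>hit S\<close> is \<open>\<Diamond>\<^sub>S\<close> and \<open>miss S\<close> is \<open>\<box>\<^sub>S\<close>; note that \<open>\<box>\<^sub>S\<close> means
  disjointness from \<open>S\<close>, not inclusion in \<open>S\<close>.\<close>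

definition hit :: "'a::{distrib_lattice,bounded_lattice} set set \<Rightarrow> 'a set set set" where
  "hit S = {C \<in> CC. C \<inter> S \<noteq> {}}"

definition miss :: "'a::{distrib_lattice,bounded_lattice} set set \<Rightarrow> 'a set set set" where
  "miss S = {C \<in> CC. C \<inter> S = {}}"

definition hit_or_miss_topology :: "'a::{distrib_lattice,bounded_lattice} set set topology" where
  "hit_or_miss_topology = topology_generated_by
     (range (\<lambda>a. miss (pos a)) \<union> range (\<lambda>a. miss (neg a)) \<union>
      range (\<lambda>a. hit (pos a)) \<union> range (\<lambda>a. hit (neg a)))"

lemma topspace_hit_or_miss_topology [simp]: "topspace hit_or_miss_topology = CC"
  by (auto simp: hit_or_miss_topology_def topology_generated_by_topspace hit_def miss_def)

definition C_of_filter :: "'a::{distrib_lattice,bounded_lattice} set \<Rightarrow> 'a set set" where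
  "C_of_filter F = (\<Inter>a\<in>F. pos a)"

definition C_of_ideal :: "'a::{distrib_lattice,bounded_lattice} set \<Rightarrow> 'a set set" where
  "C_of_ideal I = (\<Inter>a\<in>I. neg a)"

definition filter_of :: "'a::{distrib_lattice,bounded_lattice} set set \<Rightarrow> 'a set" where
  "filter_of C = {a. C \<subseteq> pos a}"

definition ideal_of :: "'a::{distrib_lattice,bounded_lattice} set set \<Rightarrow> 'a set" where
  "ideal_of C = {a. C \<subseteq> neg a}"

definition Phi :: "'a::{distrib_lattice,bounded_lattice} set \<times> 'a set \<Rightarrow> 'a set set" where
  "Phi = (\<lambda>(F, I). C_of_filter F \<inter> C_of_ideal I)"

definition Upsilon :: "'a::{distrib_lattice,bounded_lattice} set set \<Rightarrow> 'a set \<times> 'a set" where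
  "Upsilon C = (filter_of C, ideal_of C)"

definition order_homeomorphism ::
  "'b topology \<Rightarrow> ('b \<Rightarrow> 'b \<Rightarrow> bool) \<Rightarrow> 'c topology \<Rightarrow> ('c \<Rightarrow> 'c \<Rightarrow> bool) \<Rightarrow> ('b \<Rightarrow> 'c) \<Rightarrow> bool" where
  "order_homeomorphism S leS T leT f \<longleftrightarrow>
     homeomorphic_map S T f \<and>
     (\<forall>x\<in>topspace S. \<forall>y\<in>topspace S. leS x y \<longleftrightarrow> leT (f x) (f y))"

end

theory Submission
  imports Defs
begin

text \<open>
  Compactness of the Priestley space gives \<open>x \<in> up_closure C\<close> iff \<open>filter_of C \<subseteq> x\<close>, and
  \<open>x \<in> down_closure C\<close> iff \<open>x\<close> misses \<open>ideal_of C\<close>, for every closed \<open>C\<close>. As a convex set is the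
  intersection of its up- and down-closure, \<open>Phi (Upsilon C) = C\<close>, and the Egli-Milner order turns
  into inclusion of filters and reverse inclusion of ideals. The other composite is the identity
  by the prime filter theorem. Both topologies are generated by sets that the bijection \<open>Phi\<close>
  exchanges, so it is a homeomorphism.
\<close>

section \<open>Filters and ideals of a bounded distributive lattice\<close>

lemma lattice_filter_mono: "lattice_filter F \<Longrightarrow> a \<in> F \<Longrightarrow> a \<le> b \<Longrightarrow> b \<in> F"
  and lattice_filter_inf: "lattice_filter F \<Longrightarrow> a \<in> F \<Longrightarrow> b \<in> F \<Longrightarrow> inf a b \<in> F"
  and lattice_filter_nonempty: "lattice_filter F \<Longrightarrow> F \<noteq> {}"
  by (auto simp: lattice_filter_def)

lemma lattice_ideal_mono: "lattice_ideal I \<Longrightarrow> b \<in> I \<Longrightarrow> a \<le> b \<Longrightarrow> a \<in> I"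
  and lattice_ideal_sup: "lattice_ideal I \<Longrightarrow> a \<in> I \<Longrightarrow> b \<in> I \<Longrightarrow> sup a b \<in> I"
  and lattice_ideal_nonempty: "lattice_ideal I \<Longrightarrow> I \<noteq> {}"
  by (auto simp: lattice_ideal_def)

lemma lattice_filter_top: "lattice_filter F \<Longrightarrow> top \<in> F"
  by (metis all_not_in_conv lattice_filter_mono lattice_filter_nonempty top_greatest)

lemma lattice_ideal_bot: "lattice_ideal I \<Longrightarrow> bot \<in> I"
  by (metis all_not_in_conv lattice_ideal_mono lattice_ideal_nonempty bot_least)

text \<open>\<open>G\<close> is the filter generated by \<open>F\<close> and \<open>a\<close>. Its
  last property lets membership in \<open>G\<close> be traced back to a single \<open>f\<close> in
  \<open>F\<close>.\<close>

lemma lattice_filter_adjoin: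
  assumes "lattice_filter F"
  obtains G where "lattice_filter G" "F \<subseteq> G" "a \<in> G" "\<And>c. c \<in> G \<Longrightarrow> \<exists>f\<in>F. inf f a \<le> c"
proof
  let ?G = "{c. \<exists>f\<in>F. inf f a \<le> c}"
  have "inf c d \<in> ?G" if cd: "c \<in> ?G" "d \<in> ?G" for c d
  proof -
    obtain f g where fg: "f \<in> F" "g \<in> F" "inf f a \<le> c" "inf g a \<le> d"
      using cd by auto
    have "inf (inf f g) a \<le> inf c d"
      using fg by (meson inf_greatest inf_le1 inf_le2 inf_mono order_refl order_trans)
    then show ?thesis
      using lattice_filter_inf[OF assms fg(1,2)] by blast
  qed
  moreover have "top \<in> ?G"
    using lattice_filter_top[OF assms] by auto
  ultimately show "lattice_filter ?G"
    unfolding lattice_filter_def using order_trans by blast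
  show "F \<subseteq> ?G"
    using inf_le1 by blast
  show "a \<in> ?G"
    using lattice_filter_top[OF assms] by auto
  show "\<exists>f\<in>F. inf f a \<le> c" if "c \<in> ?G" for c
    using that by simp
qed

text \<open>The order dual of \<open>lattice_filter_adjoin\<close>: \<open>J\<close> is the ideal
  generated by \<open>I\<close> and \<open>a\<close>.\<close>

lemma lattice_ideal_adjoin:
  assumes "lattice_ideal I"
  obtains J where "lattice_ideal J" "I \<subseteq> J" "a \<in> J" "\<And>c. c \<in> J \<Longrightarrow> \<exists>i\<in>I. c \<le> sup i a"
proof
  let ?J = "{c. \<exists>i\<in>I. c \<le> sup i a}"
  have "sup c d \<in> ?J" if cd: "c \<in> ?J" "d \<in> ?J" for c d
  proof -
    obtain i j where ij: "i \<in> I" "j \<in> I" "c \<le> sup i a" "d \<le> sup j a"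
      using cd by auto
    have "sup c d \<le> sup (sup i j) a"
      using ij by (meson sup_least sup_ge1 sup_ge2 sup_mono order_refl order_trans)
    then show ?thesis
      using lattice_ideal_sup[OF assms ij(1,2)] by blast
  qed
  moreover have "bot \<in> ?J"
    using lattice_ideal_bot[OF assms] by auto
  ultimately show "lattice_ideal ?J"
    unfolding lattice_ideal_def using order_trans by blast
  show "I \<subseteq> ?J"
    using sup_ge1 by blast
  show "a \<in> ?J"
    using lattice_ideal_bot[OF assms] by auto
  show "\<exists>i\<in>I. c \<le> sup i a" if "c \<in> ?J" for c
    using that by simp
qed

section \<open>The prime filter theorem\<close>

lemma lattice_filter_Union_chain:
  assumes "\<C> \<noteq> {}" "subset.chain {F. lattice_filter F} \<C>"
  shows "lattice_filter (\<Union>\<C>)"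
proof -
  have F: "lattice_filter F" if "F \<in> \<C>" for F
    using assms(2) that by (auto simp: subset_chain_def)
  have "inf a b \<in> \<Union>\<C>" if ab: "a \<in> \<Union>\<C>" "b \<in> \<Union>\<C>" for a b
  proof -
    obtain F G where "F \<in> \<C>" "G \<in> \<C>" "a \<in> F" "b \<in> G" "F \<subseteq> G \<or> G \<subseteq> F"
      using ab assms(2) unfolding subset_chain_def by blast
    then show ?thesis
      using F lattice_filter_inf by blast
  qed
  moreover have "top \<in> \<Union>\<C>"
    using assms(1) F lattice_filter_top by blast
  ultimately show ?thesis
    unfolding lattice_filter_def using F lattice_filter_mono by blast
qed

text \<open>By Zorn's lemma some filter is maximal among those containing \<open>F\<close> and
  disjoint from \<open>I\<close>; distributivity makes it prime.\<close>

theorem prime_filter_separation: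
  assumes F: "lattice_filter F" and I: "lattice_ideal I" and disj: "F \<inter> I = {}"
  obtains x where "x \<in> priestley_points" "F \<subseteq> x" "x \<inter> I = {}"
proof -
  let ?A = "{G. lattice_filter G \<and> F \<subseteq> G \<and> G \<inter> I = {}}"
  have "\<exists>M\<in>?A. \<forall>X\<in>?A. M \<subseteq> X \<longrightarrow> X = M"
  proof (rule subset_Zorn_nonempty)
    show "?A \<noteq> {}"
      using F disj by blast
    fix \<C> assume \<C>: "\<C> \<noteq> {}" "subset.chain ?A \<C>"
    then have "subset.chain {F. lattice_filter F} \<C>"
      by (auto simp: subset_chain_def)
    then have "lattice_filter (\<Union>\<C>)"
      using \<C>(1) by (rule lattice_filter_Union_chain[rotated])
    then show "\<Union>\<C> \<in> ?A"
      using \<C> unfolding subset_chain_def by blast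
  qed
  then obtain M where "M \<in> ?A" and maximal: "\<forall>X\<in>?A. M \<subseteq> X \<longrightarrow> X = M" ..
  then have M: "lattice_filter M" "F \<subseteq> M" "M \<inter> I = {}"
    by simp_all
  \<comment> \<open>By maximality, adjoining \<open>a\<close> to \<open>M\<close> yields a filter
    that meets \<open>I\<close>. An element of both lies above some \<open>inf m a\<close>, which is
    then in the down-closed \<open>I\<close>.\<close>
  have meets: "\<exists>m\<in>M. inf m a \<in> I" if "a \<notin> M" for a
  proof -
    obtain G where G: "lattice_filter G" "M \<subseteq> G" "a \<in> G" "\<And>c. c \<in> G \<Longrightarrow> \<exists>m\<in>M. inf m a \<le> c"
      by (rule lattice_filter_adjoin[OF M(1), of a]) blast
    have "G \<notin> ?A"
      using maximal[rule_format, OF _ G(2)] G(3) that by blast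
    then have "G \<inter> I \<noteq> {}"
      using G(1) order_trans[OF M(2) G(2)] by simp
    then obtain c m where "c \<in> I" "m \<in> M" "inf m a \<le> c"
      using G(4) by blast
    then show ?thesis
      using lattice_ideal_mono[OF I] by auto
  qed
  have "a \<in> M \<or> b \<in> M" if ab: "sup a b \<in> M" for a b
  proof (rule ccontr)
    assume "\<not> (a \<in> M \<or> b \<in> M)"
    then obtain m n where mn: "m \<in> M" "n \<in> M" "inf m a \<in> I" "inf n b \<in> I"
      using meets by blast
    \<comment> \<open>A common bound below \<open>m\<close> and \<open>n\<close> puts both meets
      into \<open>I\<close>. Distributivity turns their join into \<open>inf ?k (sup a b)\<close>,
      an element of both \<open>M\<close> and \<open>I\<close>.\<close>
    let ?k = "inf m n"
    have "inf ?k a \<le> inf m a" "inf ?k b \<le> inf n b"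
      by (auto intro: le_infI1 le_infI2)
    then have "inf ?k a \<in> I" "inf ?k b \<in> I"
      using lattice_ideal_mono[OF I] mn by blast+
    then have "inf ?k (sup a b) \<in> I"
      unfolding inf_sup_distrib1 by (rule lattice_ideal_sup[OF I])
    moreover have "inf ?k (sup a b) \<in> M"
      using lattice_filter_inf[OF M(1) lattice_filter_inf[OF M(1) mn(1,2)] ab] .
    ultimately show False
      using M(3) by blast
  qed
  \<comment> \<open>\<open>M\<close> is proper because it misses the nonempty
    \<open>I\<close>.\<close>
  then have "M \<in> priestley_points"
    using M lattice_ideal_nonempty[OF I] unfolding priestley_points_def prime_filter_def by blast
  then show ?thesis
    using that M by blast
qed

section \<open>The Priestley space: subbasic clopen sets and compactness\<close>

lemma priestley_pointD:
  assumes "x \<in> priestley_points"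
  shows "lattice_filter x" "top \<in> x" "bot \<notin> x"
    "sup a b \<in> x \<longleftrightarrow> a \<in> x \<or> b \<in> x" "inf a b \<in> x \<longleftrightarrow> a \<in> x \<and> b \<in> x"
    "a \<le> b \<Longrightarrow> a \<in> x \<Longrightarrow> b \<in> x"
proof -
  show F: "lattice_filter x"
    using assms by (auto simp: priestley_points_def prime_filter_def)
  show "top \<in> x"
    using lattice_filter_top[OF F] .
  show "a \<le> b \<Longrightarrow> a \<in> x \<Longrightarrow> b \<in> x" for a b
    using lattice_filter_mono[OF F] by blast
  then show "bot \<notin> x"
    using assms bot_least unfolding priestley_points_def prime_filter_def by blast
  show "sup a b \<in> x \<longleftrightarrow> a \<in> x \<or> b \<in> x"
    using assms lattice_filter_mono[OF F] sup_ge1 sup_ge2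
    unfolding priestley_points_def prime_filter_def by blast
  show "inf a b \<in> x \<longleftrightarrow> a \<in> x \<and> b \<in> x"
    using lattice_filter_mono[OF F _ inf_le1] lattice_filter_mono[OF F _ inf_le2]
      lattice_filter_inf[OF F] by blast
qed

lemma pos_lattice:
  "pos bot = {}" "pos top = priestley_points"
  "pos (sup a b) = pos a \<union> pos b" "pos (inf a b) = pos a \<inter> pos b" "a \<le> b \<Longrightarrow> pos a \<subseteq> pos b"
  by (auto simp: pos_def priestley_pointD intro: priestley_pointD(6))

lemma neg_lattice:
  "neg bot = priestley_points" "neg top = {}"
  "neg (sup a b) = neg a \<inter> neg b" "neg (inf a b) = neg a \<union> neg b" "a \<le> b \<Longrightarrow> neg b \<subseteq> neg a"
  by (auto simp: neg_def priestley_pointD intro: priestley_pointD(6))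

lemma openin_pos: "openin priestley_topology (pos a)"
  and openin_neg: "openin priestley_topology (neg a)"
  unfolding priestley_topology_def by (auto intro: topology_generated_by_Basis)

lemma closedin_pos: "closedin priestley_topology (pos a)"
  and closedin_neg: "closedin priestley_topology (neg a)"
proof -
  have "priestley_points - pos a = neg a" "priestley_points - neg a = pos a"
    by (auto simp: pos_def neg_def)
  then show "closedin priestley_topology (pos a)" "closedin priestley_topology (neg a)"
    by (simp_all add: closedin_def openin_pos openin_neg) (auto simp: pos_def neg_def)
qed

text \<open>Bridges two descriptions of a generated topology, so that
  \<open>Alexander_subbase\<close>, stated for the left one, applies to
  \<open>priestley_topology\<close>. One inclusion is induction over generated open sets, the other
  minimality of the subbase topology.\<close>

lemma topology_subbase_eq_generated:
  "topology (arbitrary union_of (finite intersection_of (\<lambda>x. x \<in> \<B>) relative_to \<Union>\<B>)) =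
    topology_generated_by \<B>" (is "?X = ?Y")
proof -
  have "openin ?X S" if "generate_topology_on \<B> S" for S
    using that
  proof induction
    case (Basis s)
    then have "(finite intersection_of (\<lambda>x. x \<in> \<B>) relative_to \<Union>\<B>) s"
      by (metis Union_upper finite_intersection_of_inc relative_to_subset_inc)
    then show ?case
      by (simp add: openin_subbase arbitrary_union_of_inc)
  qed auto
  moreover have "openin ?Y S" if "openin ?X S" for S
    using that
  proof (rule minimal_topology_subbase[rotated 2])
    show "openin ?Y (\<Union>\<B>)"
      by (metis openin_topspace topology_generated_by_topspace)
  qed (simp add: topology_generated_by_Basis)
  ultimately show ?thesis
    by (auto simp: topology_eq openin_topology_generated_by_iff)
qed

text \<open>For a subbasic cover, the \<open>c\<close> whose \<open>pos c\<close> is finitely covered form an ideal, and those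
  whose \<open>neg c\<close> is finitely covered form a filter. A prime filter separating the two would be an
  uncovered point, so they share some \<open>c\<close>, and \<open>pos c \<union> neg c\<close> is the whole space.\<close>

theorem compact_space_priestley: "compact_space priestley_topology"
proof (rule Alexander_subbase[OF topology_subbase_eq_generated[of "range pos \<union> range neg",
        folded priestley_topology_def]])
  fix \<U> :: "'a set set set"
  assume sub: "\<U> \<subseteq> range pos \<union> range neg" and cov: "\<Union>\<U> = topspace priestley_topology"
  define \<A> where "\<A> = {c. \<exists>\<F>. finite \<F> \<and> \<F> \<subseteq> \<U> \<and> pos c \<subseteq> \<Union>\<F>}"
  define \<B> where "\<B> = {c. \<exists>\<F>. finite \<F> \<and> \<F> \<subseteq> \<U> \<and> neg c \<subseteq> \<Union>\<F>}"
  have "sup a b \<in> \<A>" if ab: "a \<in> \<A>" "b \<in> \<A>" for a b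
  proof -
    obtain \<F> \<G> where "finite \<F>" "\<F> \<subseteq> \<U>" "pos a \<subseteq> \<Union>\<F>" "finite \<G>" "\<G> \<subseteq> \<U>" "pos b \<subseteq> \<Union>\<G>"
      using ab unfolding \<A>_def by auto
    then have "finite (\<F> \<union> \<G>)" "\<F> \<union> \<G> \<subseteq> \<U>" "pos (sup a b) \<subseteq> \<Union>(\<F> \<union> \<G>)"
      by (auto simp: pos_lattice)
    then show ?thesis
      unfolding \<A>_def by blast
  qed
  moreover have "bot \<in> \<A>"
    unfolding \<A>_def by (intro CollectI exI[of _ "{}"]) (simp add: pos_lattice)
  moreover have "a \<in> \<A>" if "b \<in> \<A>" "a \<le> b" for a b
    using that(1) pos_lattice(5)[OF that(2)] unfolding \<A>_def mem_Collect_eq by (meson order_trans)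
  ultimately have A: "lattice_ideal \<A>"
    unfolding lattice_ideal_def by blast
  have "inf a b \<in> \<B>" if ab: "a \<in> \<B>" "b \<in> \<B>" for a b
  proof -
    obtain \<F> \<G> where "finite \<F>" "\<F> \<subseteq> \<U>" "neg a \<subseteq> \<Union>\<F>" "finite \<G>" "\<G> \<subseteq> \<U>" "neg b \<subseteq> \<Union>\<G>"
      using ab unfolding \<B>_def by auto
    then have "finite (\<F> \<union> \<G>)" "\<F> \<union> \<G> \<subseteq> \<U>" "neg (inf a b) \<subseteq> \<Union>(\<F> \<union> \<G>)"
      by (auto simp: neg_lattice)
    then show ?thesis
      unfolding \<B>_def by blast
  qed
  moreover have "top \<in> \<B>"
    unfolding \<B>_def by (intro CollectI exI[of _ "{}"]) (simp add: neg_lattice)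
  moreover have "b \<in> \<B>" if "a \<in> \<B>" "a \<le> b" for a b
    using that(1) neg_lattice(5)[OF that(2)] unfolding \<B>_def mem_Collect_eq by (meson order_trans)
  ultimately have B: "lattice_filter \<B>"
    unfolding lattice_filter_def by blast
  have "\<B> \<inter> \<A> \<noteq> {}"
  proof
    assume "\<B> \<inter> \<A> = {}"
    then obtain x where x: "x \<in> priestley_points" "\<B> \<subseteq> x" "x \<inter> \<A> = {}"
      using prime_filter_separation[OF B A] by blast
    then have "x \<in> \<Union>\<U>"
      using cov by simp
    then obtain U where U: "U \<in> \<U>" "x \<in> U"
      by blast
    \<comment> \<open>The single set \<open>U\<close> is a finite cover of itself, so
      \<open>a\<close> lies in \<open>\<A>\<close> if \<open>U = pos a\<close> and in
      \<open>\<B>\<close> if \<open>U = neg a\<close>. Either contradicts the choice of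
      \<open>x\<close>.\<close>
    then consider a where "U = pos a" | a where "U = neg a"
      using sub by blast
    then show False
    proof cases
      case 1
      then have "a \<in> \<A>"
        unfolding \<A>_def using U by (intro CollectI exI[of _ "{U}"]) auto
      then show False
        using 1 U x by (auto simp: pos_def)
    next
      case 2
      then have "a \<in> \<B>"
        unfolding \<B>_def using U by (intro CollectI exI[of _ "{U}"]) auto
      then show False
        using 2 U x by (auto simp: neg_def)
    qed
  qed
  then obtain c \<F> \<G> where "finite \<F>" "\<F> \<subseteq> \<U>" "neg c \<subseteq> \<Union>\<F>" "finite \<G>" "\<G> \<subseteq> \<U>" "pos c \<subseteq> \<Union>\<G>"
    unfolding \<A>_def \<B>_def by auto
  moreover have "priestley_points \<subseteq> pos c \<union> neg c"
    by (auto simp: pos_def neg_def)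
  ultimately have "finite (\<F> \<union> \<G>)" "\<F> \<union> \<G> \<subseteq> \<U>" "topspace priestley_topology \<subseteq> \<Union>(\<F> \<union> \<G>)"
    by auto
  then show "\<exists>\<F>. finite \<F> \<and> \<F> \<subseteq> \<U> \<and> \<Union>\<F> = topspace priestley_topology"
    by (metis Union_mono cov subset_antisym)
qed

section \<open>Up- and down-closures of closed sets\<close>

lemma closed_subset_points: "closedin priestley_topology C \<Longrightarrow> C \<subseteq> priestley_points"
  using closedin_subset by fastforce

lemma finite_Un_pos: "finite A \<Longrightarrow> \<exists>c. pos c = (\<Union>a\<in>A. pos a)"
proof (induction rule: finite_induct)
  case (insert a A)
  then show ?case
    by (metis UN_insert pos_lattice(3))
qed (use pos_lattice(1) in auto)

text \<open>As \<open>neg\<close> turns meets into unions, \<open>c\<close> is the meet of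
  \<open>A\<close>, with \<open>top\<close> for the empty set.\<close>

lemma finite_Un_neg: "finite A \<Longrightarrow> \<exists>c. neg c = (\<Union>a\<in>A. neg a)"
proof (induction rule: finite_induct)
  case (insert a A)
  then show ?case
    by (metis UN_insert neg_lattice(4))
qed (use neg_lattice(2) in auto)

text \<open>A closed set is compact here, and a finite subcover by sets \<open>pos a\<close>
  collapses to one \<open>pos c\<close>, with \<open>c\<close> a finite join from \<open>A\<close>.
  A prime filter containing \<open>c\<close> contains one of the joined elements.\<close>

lemma closed_cover_pos:
  assumes "closedin priestley_topology C" "C \<subseteq> (\<Union>a\<in>A. pos a)"
  obtains c where "C \<subseteq> pos c" "\<And>x. x \<in> pos c \<Longrightarrow> x \<inter> A \<noteq> {}"
proof -
  have "openin priestley_topology U" if "U \<in> pos ` A" for U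
    using that openin_pos by auto
  then obtain \<F> where \<F>: "finite \<F>" "\<F> \<subseteq> pos ` A" "C \<subseteq> \<Union>\<F>"
    using compactinD[OF closedin_compact_space[OF compact_space_priestley assms(1)] _ assms(2)]
    by meson
  then obtain A' where A': "A' \<subseteq> A" "finite A'" "\<F> = pos ` A'"
    by (metis finite_subset_image)
  then obtain c where c: "pos c = (\<Union>a\<in>A'. pos a)"
    using finite_Un_pos by blast
  have "x \<inter> A \<noteq> {}" if "x \<in> pos c" for x
    using that A'(1) unfolding c by (auto simp: pos_def)
  then show ?thesis
    using that[of c] \<F>(3) unfolding c A'(3) by blast
qed

text \<open>Dual to \<open>closed_cover_pos\<close>: now \<open>c\<close> is a finite meet from
  \<open>A\<close>, and a prime filter omitting it omits one of the factors.\<close>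

lemma closed_cover_neg:
  assumes "closedin priestley_topology C" "C \<subseteq> (\<Union>a\<in>A. neg a)"
  obtains c where "C \<subseteq> neg c" "\<And>x. x \<in> neg c \<Longrightarrow> \<not> A \<subseteq> x"
proof -
  have "openin priestley_topology U" if "U \<in> neg ` A" for U
    using that openin_neg by auto
  then obtain \<F> where \<F>: "finite \<F>" "\<F> \<subseteq> neg ` A" "C \<subseteq> \<Union>\<F>"
    using compactinD[OF closedin_compact_space[OF compact_space_priestley assms(1)] _ assms(2)]
    by meson
  then obtain A' where A': "A' \<subseteq> A" "finite A'" "\<F> = neg ` A'"
    by (metis finite_subset_image)
  then obtain c where c: "neg c = (\<Union>a\<in>A'. neg a)"
    using finite_Un_neg by blast
  have "\<not> A \<subseteq> x" if "x \<in> neg c" for x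
    using that A'(1) unfolding c by (auto simp: neg_def)
  then show ?thesis
    using that[of c] \<F>(3) unfolding c A'(3) by blast
qed

lemma up_closure_closed:
  assumes C: "closedin priestley_topology C"
  shows "up_closure C = {x \<in> priestley_points. filter_of C \<subseteq> x}"
proof -
  have "\<exists>y\<in>C. y \<subseteq> x" if x: "x \<in> priestley_points" "filter_of C \<subseteq> x" for x
  proof (rule ccontr)
    assume "\<not> ?thesis"
    \<comment> \<open>Every \<open>y\<close> in \<open>C\<close> has an element outside
      \<open>x\<close>; these elements index the cover.\<close>
    then have "C \<subseteq> (\<Union>a\<in>- x. pos a)"
      using closed_subset_points[OF C] by (auto simp: pos_def)
    then obtain c where "C \<subseteq> pos c" "\<And>y. y \<in> pos c \<Longrightarrow> y \<inter> - x \<noteq> {}"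
      using closed_cover_pos[OF C] by blast
    \<comment> \<open>\<open>c\<close> lies in \<open>filter_of C\<close>, hence in
      \<open>x\<close>, so \<open>x\<close> itself would have to meet \<open>- x\<close>.\<close>
    then show False
      using x by (auto simp: filter_of_def pos_def)
  qed
  then show ?thesis
    by (auto simp: up_closure_def filter_of_def pos_def)
qed

lemma down_closure_closed:
  assumes C: "closedin priestley_topology C"
  shows "down_closure C = {x \<in> priestley_points. x \<inter> ideal_of C = {}}"
proof -
  have "\<exists>y\<in>C. x \<subseteq> y" if x: "x \<in> priestley_points" "x \<inter> ideal_of C = {}" for x
  proof (rule ccontr)
    assume "\<not> ?thesis"
    then have "C \<subseteq> (\<Union>a\<in>x. neg a)"
      using closed_subset_points[OF C] by (auto simp: neg_def)
    then obtain c where c: "C \<subseteq> neg c" "\<And>y. y \<in> neg c \<Longrightarrow> \<not> x \<subseteq> y"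
      using closed_cover_neg[OF C] by blast
    \<comment> \<open>\<open>c\<close> lies in \<open>ideal_of C\<close>, so \<open>x\<close> omits
      it and is a point of \<open>neg c\<close>; but then \<open>x\<close> would not be contained in
      itself.\<close>
    then show False
      using x by (auto simp: ideal_of_def neg_def)
  qed
  then show ?thesis
    by (auto simp: down_closure_def ideal_of_def neg_def)
qed

section \<open>\<open>Phi\<close> and \<open>Upsilon\<close> as mutually inverse maps\<close>

lemma Phi_eq:
  assumes "lattice_filter F"
  shows "Phi (F, I) = {x \<in> priestley_points. F \<subseteq> x \<and> x \<inter> I = {}}"
  \<comment> \<open>An intersection over the empty set would be all of \<open>UNIV\<close>; a member
    of \<open>F\<close> confines \<open>C_of_filter F\<close> to
    \<open>priestley_points\<close>.\<close>
  using lattice_filter_nonempty[OF assms]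
  by (auto simp: Phi_def C_of_filter_def C_of_ideal_def pos_def neg_def)

lemma WP_iff:
  "(F, I) \<in> WP \<longleftrightarrow> lattice_filter F \<and> lattice_ideal I \<and>
    (\<forall>a b. sup a b \<in> F \<longrightarrow> b \<in> I \<longrightarrow> a \<in> F) \<and> (\<forall>a b. inf a b \<in> I \<longrightarrow> a \<in> F \<longrightarrow> b \<in> I)"
  unfolding WP_def weakly_prime_pair_def by auto

lemma Phi_in_CC:
  assumes "p \<in> WP"
  shows "Phi p \<in> CC"
proof -
  obtain F I where p: "p = (F, I)"
    by fastforce
  have FI: "lattice_filter F" "lattice_ideal I"
    using assms by (auto simp: p WP_iff)
  have "closedin priestley_topology (Phi p)"
    unfolding p Phi_def C_of_filter_def C_of_ideal_def
    using FI by (auto intro!: closedin_Inter closedin_Int closedin_pos closedin_neg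
        dest: lattice_filter_nonempty lattice_ideal_nonempty)
  \<comment> \<open>Containing \<open>F\<close> is inherited by larger points, missing
    \<open>I\<close> by smaller ones.\<close>
  moreover have "order_convex (Phi p)"
    unfolding p Phi_eq[OF FI(1)] order_convex_def by blast
  ultimately show ?thesis
    by (simp add: CC_def)
qed

lemma lattice_filter_filter_of: "C \<subseteq> priestley_points \<Longrightarrow> lattice_filter (filter_of C)"
  unfolding lattice_filter_def filter_of_def using pos_lattice(2,4,5) by blast

lemma lattice_ideal_ideal_of: "C \<subseteq> priestley_points \<Longrightarrow> lattice_ideal (ideal_of C)"
  unfolding lattice_ideal_def ideal_of_def using neg_lattice(1,3,5) by blast

lemma Upsilon_in_WP:
  assumes "C \<in> CC"
  shows "Upsilon C \<in> WP"
proof -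
  have C: "C \<subseteq> priestley_points"
    using assms closed_subset_points by (auto simp: CC_def)
  \<comment> \<open>Weak primeness holds pointwise: a point of \<open>C\<close> contains
    \<open>a\<close> or \<open>b\<close>, and no point of \<open>C\<close> contains
    \<open>b\<close>. The other half is dual.\<close>
  have "C \<subseteq> pos a" if "C \<subseteq> pos (sup a b)" "C \<subseteq> neg b" for a b
    using that unfolding pos_lattice by (auto simp: pos_def neg_def)
  moreover have "C \<subseteq> neg b" if "C \<subseteq> neg (inf a b)" "C \<subseteq> pos a" for a b
    using that unfolding neg_lattice by (auto simp: pos_def neg_def)
  ultimately show ?thesis
    using lattice_filter_filter_of[OF C] lattice_ideal_ideal_of[OF C]
    unfolding Upsilon_def WP_iff filter_of_def ideal_of_def by blast
qed

lemma Phi_Upsilon: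
  assumes "C \<in> CC"
  shows "Phi (Upsilon C) = C"
proof -
  have C: "closedin priestley_topology C" "order_convex C"
    using assms by (auto simp: CC_def)
  have "Phi (Upsilon C) = up_closure C \<inter> down_closure C"
    unfolding Upsilon_def Phi_eq[OF lattice_filter_filter_of[OF closed_subset_points[OF C(1)]]]
      up_closure_closed[OF C(1)] down_closure_closed[OF C(1)] by blast
  also have "\<dots> = C"
  proof
    show "up_closure C \<inter> down_closure C \<subseteq> C"
    proof
      fix z assume "z \<in> up_closure C \<inter> down_closure C"
      then obtain x y where "x \<in> C" "y \<in> C" "x \<subseteq> z" "z \<subseteq> y" "z \<in> priestley_points"
        by (auto simp: up_closure_def down_closure_def)
      then show "z \<in> C"
        using C(2)[unfolded order_convex_def, rule_format, of x y z] by simp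
    qed
    show "C \<subseteq> up_closure C \<inter> down_closure C"
      using closed_subset_points[OF C(1)] by (auto simp: up_closure_def down_closure_def)
  qed
  finally show ?thesis .
qed

text \<open>Weak primeness says exactly that \<open>F\<close> is disjoint from the ideal generated by \<open>I\<close> and any
  \<open>a \<notin> F\<close>, and dually, so prime filters separating these recover \<open>F\<close> and \<open>I\<close>.\<close>

lemma Upsilon_Phi:
  assumes "p \<in> WP"
  shows "Upsilon (Phi p) = p"
proof -
  obtain F I where p: "p = (F, I)"
    by fastforce
  have F: "lattice_filter F" and I: "lattice_ideal I"
    and FI: "\<And>a b. sup a b \<in> F \<Longrightarrow> b \<in> I \<Longrightarrow> a \<in> F"
    and IF: "\<And>a b. inf a b \<in> I \<Longrightarrow> a \<in> F \<Longrightarrow> b \<in> I"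
    using assms unfolding p WP_iff by blast+
  have "a \<in> F" if a: "a \<in> filter_of (Phi p)" for a
  proof (rule ccontr)
    assume "a \<notin> F"
    obtain J where J: "lattice_ideal J" "I \<subseteq> J" "a \<in> J" "\<And>c. c \<in> J \<Longrightarrow> \<exists>i\<in>I. c \<le> sup i a"
      by (rule lattice_ideal_adjoin[OF I, of a]) blast
    have "c \<notin> F" if c: "c \<in> J" for c
    proof
      assume "c \<in> F"
      \<comment> \<open>The join is commuted to match \<open>FI\<close>, whose second argument is
        the one in \<open>I\<close>. Since \<open>sup a i\<close> is in \<open>F\<close>, weak
        primeness would put \<open>a\<close> into \<open>F\<close>.\<close>
      obtain i where i: "i \<in> I" "c \<le> sup a i"
        using J(4)[OF c] by (auto simp: sup_commute)
      show False
        using FI[OF lattice_filter_mono[OF F \<open>c \<in> F\<close> i(2)] i(1)] \<open>a \<notin> F\<close> by contradiction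
    qed
    then have "F \<inter> J = {}"
      by blast
    then obtain x where x: "x \<in> priestley_points" "F \<subseteq> x" "x \<inter> J = {}"
      by (rule prime_filter_separation[OF F J(1)])
    \<comment> \<open>Missing \<open>J\<close> means missing both \<open>I\<close> and
      \<open>a\<close>, so \<open>x\<close> witnesses that \<open>Phi p\<close> is not inside
      \<open>pos a\<close>.\<close>
    then have "x \<in> Phi p" "a \<notin> x"
      unfolding p Phi_eq[OF F] using x J(2,3) by blast+
    then show False
      using a by (auto simp: filter_of_def pos_def)
  qed
  moreover have "a \<in> I" if a: "a \<in> ideal_of (Phi p)" for a
  proof (rule ccontr)
    assume "a \<notin> I"
    obtain G where G: "lattice_filter G" "F \<subseteq> G" "a \<in> G" "\<And>c. c \<in> G \<Longrightarrow> \<exists>f\<in>F. inf f a \<le> c"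
      by (rule lattice_filter_adjoin[OF F, of a]) blast
    have "c \<notin> I" if c: "c \<in> G" for c
    proof
      assume "c \<in> I"
      obtain f where f: "f \<in> F" "inf f a \<le> c"
        using G(4)[OF c] by blast
      \<comment> \<open>\<open>inf f a\<close> lies below \<open>c\<close>, hence in
        \<open>I\<close>, and weak primeness with \<open>f\<close> in \<open>F\<close> would put
        \<open>a\<close> into \<open>I\<close>.\<close>
      show False
        using IF[OF lattice_ideal_mono[OF I \<open>c \<in> I\<close> f(2)] f(1)] \<open>a \<notin> I\<close> by contradiction
    qed
    then have "G \<inter> I = {}"
      by blast
    then obtain x where x: "x \<in> priestley_points" "G \<subseteq> x" "x \<inter> I = {}"
      by (rule prime_filter_separation[OF G(1) I])
    then have "x \<in> Phi p" "a \<in> x"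
      unfolding p Phi_eq[OF F] using x G(2,3) by blast+
    then show False
      using a by (auto simp: ideal_of_def neg_def)
  qed
  moreover have "F \<subseteq> filter_of (Phi p)" "I \<subseteq> ideal_of (Phi p)"
    unfolding p Phi_eq[OF F] filter_of_def ideal_of_def pos_def neg_def by blast+
  ultimately show ?thesis
    unfolding p Upsilon_def by blast
qed

section \<open>Transfer of the topology and the order\<close>

lemma bij_betw_Phi: "bij_betw Phi WP CC"
  by (rule bij_betw_byWitness[of _ Upsilon])
    (auto simp: Upsilon_Phi Phi_Upsilon Phi_in_CC Upsilon_in_WP)

text \<open>The image under a bijection is the preimage under its inverse. This reduces the images
  of the subbasic sets to membership conditions on \<open>Upsilon C\<close>.\<close>

lemma Phi_image_Collect:
  "Phi ` {p \<in> WP. P p} = {C \<in> CC. P (Upsilon C)}"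
  by (force simp: Upsilon_Phi Phi_Upsilon Phi_in_CC Upsilon_in_WP image_iff)

lemma Phi_image_subbase:
  "Phi ` wp_box_up a = miss (neg a)" "Phi ` wp_box_down a = hit (neg a)"
  "Phi ` wp_dia_up a = hit (pos a)" "Phi ` wp_dia_down a = miss (pos a)"
proof -
  have sub: "C \<subseteq> priestley_points" if "C \<in> CC" for C :: "'a set set"
    using that closed_subset_points by (auto simp: CC_def)
  have eqs: "wp_box_up a = {p \<in> WP. a \<in> fst p}" "wp_box_down a = {p \<in> WP. a \<notin> fst p}"
    "wp_dia_up a = {p \<in> WP. a \<notin> snd p}" "wp_dia_down a = {p \<in> WP. a \<in> snd p}"
    unfolding wp_box_up_def wp_box_down_def wp_dia_up_def wp_dia_down_def by auto
  \<comment> \<open>Within \<open>priestley_points\<close> the sets \<open>pos a\<close> and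
    \<open>neg a\<close> are complementary, so inclusion in one is disjointness from the
    other.\<close>
  have F: "a \<in> fst (Upsilon C) \<longleftrightarrow> C \<inter> neg a = {}" if "C \<in> CC" for C
    using sub[OF that] by (auto simp: Upsilon_def filter_of_def pos_def neg_def)
  have I: "a \<in> snd (Upsilon C) \<longleftrightarrow> C \<inter> pos a = {}" if "C \<in> CC" for C
    using sub[OF that] by (auto simp: Upsilon_def ideal_of_def pos_def neg_def)
  show "Phi ` wp_box_up a = miss (neg a)" "Phi ` wp_box_down a = hit (neg a)"
    "Phi ` wp_dia_up a = hit (pos a)" "Phi ` wp_dia_down a = miss (pos a)"
    unfolding eqs Phi_image_Collect hit_def miss_def using F I by auto
qed

text \<open>The preimage of a generator under \<open>f\<close> is its image under the inverse
  \<open>g\<close>, which is again a generator and hence open.\<close>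

lemma continuous_map_generated_inverse:
  assumes "\<And>x. x \<in> \<Union>\<S> \<Longrightarrow> f x \<in> \<Union>\<T> \<and> g (f x) = x" "\<And>y. y \<in> \<Union>\<T> \<Longrightarrow> g y \<in> \<Union>\<S> \<and> f (g y) = y"
    and "\<And>V. V \<in> \<T> \<Longrightarrow> g ` V \<in> \<S>"
  shows "continuous_map (topology_generated_by \<S>) (topology_generated_by \<T>) f"
proof (rule continuous_on_generated_topo)
  fix V assume V: "V \<in> \<T>"
  then have "f -` V \<inter> topspace (topology_generated_by \<S>) = g ` V"
    unfolding topology_generated_by_topspace using assms(1,2) by (force simp: image_iff)
  then show "openin (topology_generated_by \<S>) (f -` V \<inter> topspace (topology_generated_by \<S>))"
    using assms(3)[OF V] by (simp add: topology_generated_by_Basis)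
next
  show "f ` topspace (topology_generated_by \<S>) \<subseteq> \<Union>\<T>"
    unfolding topology_generated_by_topspace using assms(1) by blast
qed

text \<open>Generators correspond under \<open>f\<close> and \<open>g\<close> in both directions, so
  \<open>continuous_map_generated_inverse\<close> applies to each map.\<close>

lemma homeomorphic_maps_generated:
  assumes "bij_betw f (\<Union>\<S>) (\<Union>\<T>)" "\<And>x. x \<in> \<Union>\<S> \<Longrightarrow> g (f x) = x" and \<T>: "\<T> = (`) f ` \<S>"
  shows "homeomorphic_maps (topology_generated_by \<S>) (topology_generated_by \<T>) f g"
proof -
  have f: "f x \<in> \<Union>\<T> \<and> g (f x) = x" if "x \<in> \<Union>\<S>" for x
    using bij_betwE[OF assms(1), rule_format, OF that] assms(2)[OF that] ..
  have g: "g y \<in> \<Union>\<S> \<and> f (g y) = y" if "y \<in> \<Union>\<T>" for y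
  proof -
    have "y \<in> f ` \<Union>\<S>"
      using that bij_betw_imp_surj_on[OF assms(1)] by simp
    then obtain x where "x \<in> \<Union>\<S>" "y = f x"
      by (rule imageE)
    then show ?thesis
      using assms(2) by simp
  qed
  have "g ` f ` U = U" if "U \<in> \<S>" for U
    using f that by (force simp: image_iff)
  then have "continuous_map (topology_generated_by \<S>) (topology_generated_by \<T>) f"
    by (intro continuous_map_generated_inverse[where g = g] f g) (auto simp: \<T>)
  moreover have "continuous_map (topology_generated_by \<T>) (topology_generated_by \<S>) g"
    by (intro continuous_map_generated_inverse[where g = f] f g) (auto simp: \<T>)
  ultimately show ?thesis
    using f g by (simp add: homeomorphic_maps_def)
qed

lemma homeomorphic_maps_Phi_Upsilon:
  "homeomorphic_maps wp_topology hit_or_miss_topology Phi Upsilon"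
proof -
  let ?S = "range wp_box_up \<union> range wp_box_down \<union> range wp_dia_up \<union> range wp_dia_down
    :: ('a set \<times> 'a set) set set"
  let ?T = "range (\<lambda>a. miss (pos a)) \<union> range (\<lambda>a. miss (neg a)) \<union>
      range (\<lambda>a. hit (pos a)) \<union> range (\<lambda>a. hit (neg a)) :: 'a set set set set"
  have S: "\<Union>?S = WP"
    using topspace_wp_topology unfolding wp_topology_def topology_generated_by_topspace .
  have T: "\<Union>?T = CC"
    using topspace_hit_or_miss_topology
    unfolding hit_or_miss_topology_def topology_generated_by_topspace .
  \<comment> \<open>The four families of generators match one by one through
    \<open>Phi_image_subbase\<close>, up to the order of the unions.\<close>
  have "?T = (`) Phi ` ?S"
    unfolding image_Un image_image Phi_image_subbase by auto
  then show ?thesis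
    unfolding wp_topology_def hit_or_miss_topology_def
    by (intro homeomorphic_maps_generated) (unfold S T, auto simp: bij_betw_Phi Upsilon_Phi)
qed

lemma egli_milner_iff_wp_le:
  assumes "A \<in> CC" "B \<in> CC"
  shows "egli_milner A B \<longleftrightarrow> wp_le (Upsilon A) (Upsilon B)"
proof -
  have A: "closedin priestley_topology A" and B: "closedin priestley_topology B"
    using assms by (auto simp: CC_def)
  \<comment> \<open>By the description of \<open>down_closure B\<close>, both sides say that no
    point of \<open>A\<close> contains an element of \<open>ideal_of B\<close>.\<close>
  have "A \<subseteq> down_closure B \<longleftrightarrow> ideal_of B \<subseteq> ideal_of A"
    using closed_subset_points[OF A] unfolding down_closure_closed[OF B]
    by (auto simp: ideal_of_def neg_def)
  moreover have "B \<subseteq> up_closure A \<longleftrightarrow> filter_of A \<subseteq> filter_of B"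
    using closed_subset_points[OF B] unfolding up_closure_closed[OF A]
    by (auto simp: filter_of_def pos_def)
  ultimately show ?thesis
    by (auto simp: egli_milner_def wp_le_def Upsilon_def)
qed

theorem proposition4p16:
  fixes W :: "('a::{distrib_lattice,bounded_lattice} set \<times> 'a set) set"
    and \<C> :: "'a set set set"
    and \<Phi> :: "'a set \<times> 'a set \<Rightarrow> 'a set set"
    and \<Upsilon> :: "'a set set \<Rightarrow> 'a set \<times> 'a set"
  defines "W \<equiv> WP" and "\<C> \<equiv> CC" and "\<Phi> \<equiv> Phi" and "\<Upsilon> \<equiv> Upsilon"
  shows "\<Phi> \<in> W \<rightarrow> \<C> \<and> \<Upsilon> \<in> \<C> \<rightarrow> W
    \<and> (\<forall>p\<in>W. \<Upsilon> (\<Phi> p) = p) \<and> (\<forall>C\<in>\<C>. \<Phi> (\<Upsilon> C) = C)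
    \<and> order_homeomorphism wp_topology wp_le hit_or_miss_topology egli_milner \<Phi>
    \<and> order_homeomorphism hit_or_miss_topology egli_milner wp_topology wp_le \<Upsilon>
    \<and> (\<forall>a. \<Phi> ` wp_box_up a = miss (neg a)
         \<and> \<Phi> ` wp_box_down a = hit (neg a)
         \<and> \<Phi> ` wp_dia_up a = hit (pos a)
         \<and> \<Phi> ` wp_dia_down a = miss (pos a))"
proof -
  have "homeomorphic_map wp_topology hit_or_miss_topology Phi"
    "homeomorphic_map hit_or_miss_topology wp_topology Upsilon"
    using homeomorphic_maps_Phi_Upsilon homeomorphic_maps_map by blast+
  \<comment> \<open>The order statement for \<open>Phi\<close> is
    \<open>egli_milner_iff_wp_le\<close> at sets \<open>Phi p\<close>, where \<open>Upsilon\<close>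
    returns \<open>p\<close>.\<close>
  then show ?thesis
    unfolding assms order_homeomorphism_def
    by (auto simp: Phi_in_CC Upsilon_in_WP Upsilon_Phi Phi_Upsilon egli_milner_iff_wp_le
        Phi_image_subbase)
qed

end
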